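(* Let $(X,d_1,T_1)$ and $(Y,d_2,T_2)$ be two topological dynamical systems and let $\Phi=(\varphi_n)_{n\in\mathbb N}$ be an almost additive sequence for $T_2$ (on $Y$). If $(Y,T_2)$ is a factor of $(X,T_1)$ with factor map $\pi:X\to Y$, then $PD_2(s,T_1,\Phi\circ\pi)\ge PD_2(s,T_2,\Phi)$ for every $s>0$, where $\Phi\circ\pi=(\varphi_n\circ\pi)_{n\in\mathbb N}$. Moreover, if $(X,T_1)$ and $(Y,T_2)$ are topologically conjugate with conjugate map $\pi:X\to Y$, then $PD_2(s,T_1,\Phi\circ\pi)=PD_2(s,T_2,\Phi)$ for every $s>0$.
   Context: A topological dynamical system $(X,d,T)$ is a compact metric space $(X,d)$ with a continuous map $T:X\to X$. A sequence $\Phi=(\varphi_n)_{n\in\mathbb N}$ ($\mathbb N=\{1,2,\dots\}$) of continuous functions $\varphi_n:X\to\mathbb R$ is almost additive for $T$ if there is a constant $C>0$ with $$-C+\varphi_n(x)+\varphi_m(T^n x)\le\varphi_{n+m}(x)\le\varphi_n(x)+\varphi_m(T^n x)+C$$ for all $n,m\in\mathbb N$, $x\in X$. $(Y,T_2)$ is a factor of $(X,T_1)$ with factor map $\pi$ if $\pi:X\to Y$ is a surjective continuous map with $\pi\circ T_1=T_2\circ\pi$; if in addition $\pi$ is a homeomorphism, the systems are topologically conjugate and $\pi$ is a conjugate map. For a system $(X,d,T)$ let $d_n(x,y)=\max_{0\le j<n}d(T^jx,T^jy)$. $F\subseteq X$ is $(n,\epsilon)$-spanning if for each $x\in X$ there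 is $y\in F$ with $d_n(x,y)<\epsilon$. Put $Q_n(T,\Phi,\epsilon)=\inf\{\sum_{x\in F}e^{\varphi_n(x)}:F\text{ is an }(n,\epsilon)\text{-spanning set for }X\}$ and, with values in $[-\infty,+\infty]$, $$PD_2(s,T,\Phi)=\lim_{\epsilon\to0}\limsup_{n\to\infty}\frac1{n^s}\log Q_n(T,\Phi,\epsilon).$$ *)

theory Defs
  imports "HOL-Analysis.Analysis"
begin

text \<open>
  A system $(X,d,T)$ is a compact set \<open>X\<close> in a metric space type, with \<open>d\<close> the metric \<open>dist\<close> of that
  type and \<open>T\<close> a function that only matters on \<open>X\<close>.
\<close>

definition tds :: "'a::metric_space set \<Rightarrow> ('a \<Rightarrow> 'a) \<Rightarrow> bool" where
  "tds X T \<longleftrightarrow> compact X \<and> continuous_on X T \<and> T ` X \<subseteq> X"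

text \<open>
  Sequences are indexed by the positive integers; the value at index \<open>0\<close> is irrelevant throughout.
\<close>

definition almost_additive ::
    "'a::metric_space set \<Rightarrow> ('a \<Rightarrow> 'a) \<Rightarrow> (nat \<Rightarrow> 'a \<Rightarrow> real) \<Rightarrow> bool" where
  "almost_additive X T \<phi> \<longleftrightarrow>
     (\<forall>n\<ge>1. continuous_on X (\<phi> n)) \<and>
     (\<exists>C>0. \<forall>n\<ge>1. \<forall>m\<ge>1. \<forall>x\<in>X.
        - C + \<phi> n x + \<phi> m ((T ^^ n) x) \<le> \<phi> (n + m) x \<and>
        \<phi> (n + m) x \<le> \<phi> n x + \<phi> m ((T ^^ n) x) + C)"

definition factor_map ::
    "'a::metric_space set \<Rightarrow> ('a \<Rightarrow> 'a) \<Rightarrow> 'b::metric_space set \<Rightarrow> ('b \<Rightarrow> 'b) \<Rightarrow> ('a \<Rightarrow> 'b) \<Rightarrow> bool" where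
  "factor_map X T1 Y T2 \<pi> \<longleftrightarrow>
     continuous_on X \<pi> \<and> \<pi> ` X = Y \<and> (\<forall>x\<in>X. \<pi> (T1 x) = T2 (\<pi> x))"

definition conjugate_map ::
    "'a::metric_space set \<Rightarrow> ('a \<Rightarrow> 'a) \<Rightarrow> 'b::metric_space set \<Rightarrow> ('b \<Rightarrow> 'b) \<Rightarrow> ('a \<Rightarrow> 'b) \<Rightarrow> bool" where
  "conjugate_map X T1 Y T2 \<pi> \<longleftrightarrow>
     factor_map X T1 Y T2 \<pi> \<and> (\<exists>\<rho>. homeomorphism X Y \<pi> \<rho>)"

definition bowen_dist :: "('a::metric_space \<Rightarrow> 'a) \<Rightarrow> nat \<Rightarrow> 'a \<Rightarrow> 'a \<Rightarrow> real" where
  "bowen_dist T n x y = (MAX j\<in>{..<n}. dist ((T ^^ j) x) ((T ^^ j) y))"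

definition spanning ::
    "'a::metric_space set \<Rightarrow> ('a \<Rightarrow> 'a) \<Rightarrow> nat \<Rightarrow> real \<Rightarrow> 'a set \<Rightarrow> bool" where
  "spanning X T n \<epsilon> F \<longleftrightarrow> F \<subseteq> X \<and> (\<forall>x\<in>X. \<exists>y\<in>F. bowen_dist T n x y < \<epsilon>)"

text \<open>
  Spanning sets may be infinite, so the sum is taken in \<^typ>\<open>ennreal\<close>, where it always exists.
\<close>

definition Q_span ::
    "'a::metric_space set \<Rightarrow> ('a \<Rightarrow> 'a) \<Rightarrow> (nat \<Rightarrow> 'a \<Rightarrow> real) \<Rightarrow> real \<Rightarrow> nat \<Rightarrow> ennreal" where
  "Q_span X T \<phi> \<epsilon> n =
     (INF F\<in>{F. spanning X T n \<epsilon> F}. \<Sum>\<^sub>\<infinity>x\<in>F. ennreal (exp (\<phi> n x)))"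

definition ln_ennreal :: "ennreal \<Rightarrow> ereal" where
  "ln_ennreal q = (if q = 0 then -\<infinity> else if q = \<infinity> then \<infinity> else ereal (ln (enn2real q)))"

definition PD2 ::
    "real \<Rightarrow> 'a::metric_space set \<Rightarrow> ('a \<Rightarrow> 'a) \<Rightarrow> (nat \<Rightarrow> 'a \<Rightarrow> real) \<Rightarrow> ereal" where
  "PD2 s X T \<phi> = Lim (at_right 0)
     (\<lambda>\<epsilon>. limsup (\<lambda>n. ereal (1 / real n powr s) * ln_ennreal (Q_span X T \<phi> \<epsilon> n)))"

lemma ln_ennreal_mono: "p \<le> q \<Longrightarrow> ln_ennreal p \<le> ln_ennreal q"
proof -
  assume le: "p \<le> q"
  have "ln (enn2real p) \<le> ln (enn2real q)" if "p \<noteq> 0" "q \<noteq> \<infinity>"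
  proof -
    have "0 < enn2real p"
      using that le by (auto simp: enn2real_positive_iff zero_less_iff_neq_zero less_top top_unique)
    moreover have "enn2real p \<le> enn2real q"
      using that le by (intro enn2real_mono) (auto simp: less_top)
    ultimately show ?thesis by simp
  qed
  with le show ?thesis
    by (auto simp: ln_ennreal_def top_unique)
qed

lemma Q_span_antimono: "\<epsilon> \<le> \<delta> \<Longrightarrow> Q_span X T \<phi> \<delta> n \<le> Q_span X T \<phi> \<epsilon> n"
  unfolding Q_span_def by (rule INF_superset_mono[OF _ order_refl]) (auto simp: spanning_def; meson less_le_trans)

text \<open>The limit in the definition of \<^const>\<open>PD2\<close> exists, by monotonicity in \<open>\<epsilon>\<close>.\<close>

lemma PD2_tendsto:
  "((\<lambda>\<epsilon>. limsup (\<lambda>n. ereal (1 / real n powr s) * ln_ennreal (Q_span X T \<phi> \<epsilon> n)))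
     \<longlongrightarrow> PD2 s X T \<phi>) (at_right 0)" (is "(?f \<longlongrightarrow> _) _")
proof -
  define f where "f = ?f"
  have mono: "f \<delta> \<le> f \<epsilon>" if "\<epsilon> \<le> \<delta>" for \<epsilon> \<delta>
    unfolding f_def
    by (intro Limsup_mono always_eventually allI ereal_mult_left_mono ln_ennreal_mono
        Q_span_antimono that) simp
  have "(f \<longlongrightarrow> (SUP \<epsilon>\<in>{0<..}. f \<epsilon>)) (at_right 0)"
  proof (rule order_tendstoI)
    fix a assume "a < (SUP \<epsilon>\<in>{0<..}. f \<epsilon>)"
    then obtain \<delta> where \<delta>: "\<delta> > 0" "a < f \<delta>"
      by (auto simp: less_SUP_iff)
    show "eventually (\<lambda>\<epsilon>. a < f \<epsilon>) (at_right 0)"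
    proof (rule eventually_at_rightI[OF _ \<delta>(1)])
      fix \<epsilon> assume "\<epsilon> \<in> {0<..<\<delta>}"
      then show "a < f \<epsilon>"
        using less_le_trans[OF \<delta>(2) mono[of \<epsilon> \<delta>]] by simp
    qed
  next
    fix a assume a: "(SUP \<epsilon>\<in>{0<..}. f \<epsilon>) < a"
    show "eventually (\<lambda>\<epsilon>. f \<epsilon> < a) (at_right 0)"
    proof (rule eventually_at_rightI[of 0 1])
      fix \<epsilon> :: real assume "\<epsilon> \<in> {0<..<1}"
      then have "f \<epsilon> \<le> (SUP \<epsilon>\<in>{0<..}. f \<epsilon>)"
        by (intro SUP_upper) simp
      then show "f \<epsilon> < a"
        using a by (rule le_less_trans)
    qed simp
  qed
  then have "(f \<longlongrightarrow> Lim (at_right 0) f) (at_right 0)"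
    using tendsto_Lim[OF trivial_limit_at_right_real] by metis
  then show ?thesis
    unfolding PD2_def f_def .
qed

end

theory Submission
  imports Defs
begin

text \<open>
  If \<open>\<pi>\<close> moves \<open>\<delta>\<close>-close points to \<open>\<epsilon>\<close>-close points, the image of an \<open>(n, \<delta>)\<close>-spanning set of \<open>X\<close> is
  \<open>(n, \<epsilon>)\<close>-spanning in \<open>Y\<close>, and its sum is no larger since each fibre contributes only one term;
  uniform continuity provides such a \<open>\<delta>\<close> for every \<open>\<epsilon>\<close>. The conjugate case applies this to \<open>\<pi>\<close> and to
  its inverse.
\<close>

lemma tds_funpow_in: "tds X T \<Longrightarrow> x \<in> X \<Longrightarrow> (T ^^ j) x \<in> X"
  by (induction j) (auto simp: tds_def)

lemma factor_map_funpow: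
  assumes "tds X T1" "factor_map X T1 Y T2 \<pi>" "x \<in> X"
  shows "\<pi> ((T1 ^^ j) x) = (T2 ^^ j) (\<pi> x)"
  using assms tds_funpow_in[OF assms(1,3)] by (induction j) (auto simp: factor_map_def)

text \<open>For \<open>n = 0\<close> the maximum runs over the empty set and has no specified value,
  hence \<open>n \<ge> 1\<close> here and in the lemmas on spanning sets.\<close>

lemma bowen_dist_less_iff:
  "n \<ge> 1 \<Longrightarrow> bowen_dist T n x y < \<epsilon> \<longleftrightarrow> (\<forall>j<n. dist ((T ^^ j) x) ((T ^^ j) y) < \<epsilon>)"
  unfolding bowen_dist_def by (subst Max_less_iff) (auto simp: lessThan_empty_iff)

text \<open>The orbit of \<pi> x is the image under \<pi> of the orbit of x, so closeness carries
  over separately at each time j < n.\<close>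

lemma spanning_factor_image:
  assumes X: "tds X T1" and \<pi>: "factor_map X T1 Y T2 \<pi>" and n: "n \<ge> 1"
    and \<delta>: "\<And>x x'. x \<in> X \<Longrightarrow> x' \<in> X \<Longrightarrow> dist x x' < \<delta> \<Longrightarrow> dist (\<pi> x) (\<pi> x') < \<epsilon>"
    and F: "spanning X T1 n \<delta> F"
  shows "spanning Y T2 n \<epsilon> (\<pi> ` F)"
  unfolding spanning_def
proof (intro conjI ballI)
  have FX: "F \<subseteq> X" and YX: "\<pi> ` X = Y"
    using F \<pi> by (auto simp: spanning_def factor_map_def)
  then show "\<pi> ` F \<subseteq> Y" by blast
  fix y assume "y \<in> Y"
  then obtain x where x: "x \<in> X" "y = \<pi> x" using YX by blast
  then obtain z where z: "z \<in> F" "bowen_dist T1 n x z < \<delta>"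
    using F by (auto simp: spanning_def)
  have "bowen_dist T2 n (\<pi> x) (\<pi> z) < \<epsilon>"
    unfolding bowen_dist_less_iff[OF n]
  proof (intro allI impI)
    fix j assume "j < n"
    then have "dist ((T1 ^^ j) x) ((T1 ^^ j) z) < \<delta>"
      using z(2) by (simp add: bowen_dist_less_iff[OF n])
    then have "dist (\<pi> ((T1 ^^ j) x)) (\<pi> ((T1 ^^ j) z)) < \<epsilon>"
      using x z FX by (intro \<delta> tds_funpow_in[OF X]) auto
    then show "dist ((T2 ^^ j) (\<pi> x)) ((T2 ^^ j) (\<pi> z)) < \<epsilon>"
      using factor_map_funpow[OF X \<pi>] x z FX by (metis subsetD)
  qed
  then show "\<exists>w\<in>\<pi> ` F. bowen_dist T2 n y w < \<epsilon>"
    using x z by blast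
qed

text \<open>Choosing one point of \<open>F\<close> in each fibre of \<open>h\<close> gives a subset
  \<open>G\<close> on which \<open>h\<close> is injective. The left side is then a sum over
  \<open>G\<close>, and the terms on \<open>F - G\<close> are nonnegative.\<close>

lemma infsum_image_le_ennreal:
  fixes g :: "'b \<Rightarrow> ennreal"
  shows "infsum g (h ` F) \<le> infsum (\<lambda>x. g (h x)) F"
proof -
  obtain G where G: "G \<subseteq> F" "inj_on h G" "h ` F = h ` G"
    using subset_image_inj[of "h ` F" h F] by auto
  have "infsum g (h ` F) = infsum (\<lambda>x. g (h x)) G"
    by (simp add: G infsum_reindex o_def)
  also have "\<dots> \<le> infsum (\<lambda>x. g (h x)) F"
    using G(1) by (intro infsum_mono_neutral nonneg_summable_on_complete) auto
  finally show ?thesis .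
qed

lemma Q_span_factor_le:
  assumes X: "tds X T1" and \<pi>: "factor_map X T1 Y T2 \<pi>" and n: "n \<ge> 1"
    and \<delta>: "\<And>x x'. x \<in> X \<Longrightarrow> x' \<in> X \<Longrightarrow> dist x x' < \<delta> \<Longrightarrow> dist (\<pi> x) (\<pi> x') < \<epsilon>"
    and \<psi>: "\<And>x. x \<in> X \<Longrightarrow> \<psi> n x = \<phi> n (\<pi> x)"
  shows "Q_span Y T2 \<phi> \<epsilon> n \<le> Q_span X T1 \<psi> \<delta> n"
  unfolding Q_span_def
proof (rule INF_mono)
  fix F assume "F \<in> {F. spanning X T1 n \<delta> F}"
  then have F: "spanning X T1 n \<delta> F" by simp
  have "(\<Sum>\<^sub>\<infinity>y\<in>\<pi> ` F. ennreal (exp (\<phi> n y))) \<le> (\<Sum>\<^sub>\<infinity>x\<in>F. ennreal (exp (\<phi> n (\<pi> x))))"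
    by (rule infsum_image_le_ennreal)
  also have "\<dots> = (\<Sum>\<^sub>\<infinity>x\<in>F. ennreal (exp (\<psi> n x)))"
    using F \<psi> by (intro infsum_cong) (auto simp: spanning_def)
  finally show "\<exists>G\<in>{G. spanning Y T2 n \<epsilon> G}.
      (\<Sum>\<^sub>\<infinity>y\<in>G. ennreal (exp (\<phi> n y))) \<le> (\<Sum>\<^sub>\<infinity>x\<in>F. ennreal (exp (\<psi> n x)))"
    using spanning_factor_image[OF X \<pi> n \<delta> F] by blast
qed

text \<open>Shrinking the scale leaves fewer spanning sets, so every scale below \<delta> gives at
  least the value at \<delta>; this bound passes to the limit.\<close>

lemma limsup_Q_span_le_PD2:
  assumes "\<delta> > 0"
  shows "limsup (\<lambda>n. ereal (1 / real n powr s) * ln_ennreal (Q_span X T \<phi> \<delta> n)) \<le> PD2 s X T \<phi>"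
proof (rule tendsto_lowerbound[OF PD2_tendsto])
  show "\<forall>\<^sub>F \<epsilon> in at_right 0. limsup (\<lambda>n. ereal (1 / real n powr s) * ln_ennreal (Q_span X T \<phi> \<delta> n))
      \<le> limsup (\<lambda>n. ereal (1 / real n powr s) * ln_ennreal (Q_span X T \<phi> \<epsilon> n))"
    by (rule eventually_at_rightI[OF _ assms])
      (auto intro!: Limsup_mono always_eventually ereal_mult_left_mono ln_ennreal_mono Q_span_antimono)
qed simp

text \<open>The sequence \<psi> has to agree with \<phi> \<circ> \<pi> on \<open>X\<close> only.
  This lets the lemma be applied to an inverse map, where the two sequences may differ off the
  space.\<close>

lemma PD2_factor_le:
  assumes X: "tds X T1" and \<pi>: "factor_map X T1 Y T2 \<pi>"
    and \<psi>: "\<And>n x. x \<in> X \<Longrightarrow> \<psi> n x = \<phi> n (\<pi> x)"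
  shows "PD2 s Y T2 \<phi> \<le> PD2 s X T1 \<psi>"
proof (rule tendsto_upperbound[OF PD2_tendsto])
  have "uniformly_continuous_on X \<pi>"
    using X \<pi> by (auto simp: tds_def factor_map_def intro: compact_uniformly_continuous)
  then have uc: "\<exists>\<delta>>0. \<forall>x\<in>X. \<forall>x'\<in>X. dist x x' < \<delta> \<longrightarrow> dist (\<pi> x) (\<pi> x') < \<epsilon>" if "\<epsilon> > 0" for \<epsilon>
    using that unfolding uniformly_continuous_on_def by (metis dist_commute)
  \<comment> \<open>The bound at each fixed \<epsilon> does not depend on \<epsilon>, so it survives
    the limit on the left.\<close>
  have "limsup (\<lambda>n. ereal (1 / real n powr s) * ln_ennreal (Q_span Y T2 \<phi> \<epsilon> n)) \<le> PD2 s X T1 \<psi>"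
    if \<epsilon>: "\<epsilon> > 0" for \<epsilon>
  proof -
    \<comment> \<open>This \<delta> depends on \<epsilon> alone, so it serves all n at once and the
      limsups can be compared.\<close>
    obtain \<delta> where \<delta>: "\<delta> > 0"
      "\<And>x x'. x \<in> X \<Longrightarrow> x' \<in> X \<Longrightarrow> dist x x' < \<delta> \<Longrightarrow> dist (\<pi> x) (\<pi> x') < \<epsilon>"
      using uc[OF \<epsilon>] by blast
    have "limsup (\<lambda>n. ereal (1 / real n powr s) * ln_ennreal (Q_span Y T2 \<phi> \<epsilon> n))
        \<le> limsup (\<lambda>n. ereal (1 / real n powr s) * ln_ennreal (Q_span X T1 \<psi> \<delta> n))"
      \<comment> \<open>Starting at 1 skips \<open>n = 0\<close>, where
        \<open>Q_span_factor_le\<close> does not apply.\<close>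
      by (intro Limsup_mono eventually_sequentiallyI[of 1] ereal_mult_left_mono ln_ennreal_mono
          Q_span_factor_le[OF X \<pi>] \<delta>(2) \<psi>) simp_all
    also have "\<dots> \<le> PD2 s X T1 \<psi>"
      by (rule limsup_Q_span_le_PD2[OF \<delta>(1)])
    finally show ?thesis .
  qed
  then show "\<forall>\<^sub>F \<epsilon> in at_right 0.
      limsup (\<lambda>n. ereal (1 / real n powr s) * ln_ennreal (Q_span Y T2 \<phi> \<epsilon> n)) \<le> PD2 s X T1 \<psi>"
    by (intro eventually_at_rightI[of 0 1]) auto
qed simp

lemma factor_map_inverse:
  assumes X: "tds X T1" and \<pi>: "factor_map X T1 Y T2 \<pi>" and h: "homeomorphism X Y \<pi> \<rho>"
  shows "factor_map Y T2 X T1 \<rho>"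
  unfolding factor_map_def
proof (intro conjI ballI)
  show "continuous_on Y \<rho>" "\<rho> ` Y = X"
    using h by (auto simp: homeomorphism_def)
  fix y assume "y \<in> Y"
  then have y: "\<rho> y \<in> X" "\<pi> (\<rho> y) = y"
    using h by (auto simp: homeomorphism_def)
  then have "T1 (\<rho> y) \<in> X"
    using X by (auto simp: tds_def)
  \<comment> \<open>Here \<open>T2 y = \<pi> (T1 (\<rho> y))\<close>, and \<rho> undoes \<pi> at
    \<open>T1 (\<rho> y)\<close> because that point lies in \<open>X\<close>.\<close>
  then show "\<rho> (T2 y) = T1 (\<rho> y)"
    using y \<pi> h by (metis factor_map_def homeomorphism_apply1)
qed

theorem theorem3p5:
  fixes X :: "'a::metric_space set" and T1 :: "'a \<Rightarrow> 'a"
    and Y :: "'b::metric_space set" and T2 :: "'b \<Rightarrow> 'b"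
    and \<phi> :: "nat \<Rightarrow> 'b \<Rightarrow> real" and \<pi> :: "'a \<Rightarrow> 'b"
  assumes "tds X T1" and "tds Y T2" and "almost_additive Y T2 \<phi>"
  shows "(factor_map X T1 Y T2 \<pi> \<longrightarrow>
            (\<forall>s>0. PD2 s X T1 (\<lambda>n. \<phi> n \<circ> \<pi>) \<ge> PD2 s Y T2 \<phi>)) \<and>
         (conjugate_map X T1 Y T2 \<pi> \<longrightarrow>
            (\<forall>s>0. PD2 s X T1 (\<lambda>n. \<phi> n \<circ> \<pi>) = PD2 s Y T2 \<phi>))"
proof (intro conjI impI allI)
  have le: "PD2 s Y T2 \<phi> \<le> PD2 s X T1 (\<lambda>n. \<phi> n \<circ> \<pi>)" if "factor_map X T1 Y T2 \<pi>" for s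
    by (rule PD2_factor_le[OF assms(1) that]) simp
  fix s :: real
  {
    assume "factor_map X T1 Y T2 \<pi>"
    then show "PD2 s Y T2 \<phi> \<le> PD2 s X T1 (\<lambda>n. \<phi> n \<circ> \<pi>)" by (rule le)
  next
    assume "conjugate_map X T1 Y T2 \<pi>"
    then obtain \<rho> where \<pi>: "factor_map X T1 Y T2 \<pi>" and h: "homeomorphism X Y \<pi> \<rho>"
      by (auto simp: conjugate_map_def)
    \<comment> \<open>The roles are exchanged: \<rho> is the factor map, and pulling \<phi> \<circ>
      \<pi> back along \<rho> returns \<phi> on \<open>Y\<close>.\<close>
    have "PD2 s X T1 (\<lambda>n. \<phi> n \<circ> \<pi>) \<le> PD2 s Y T2 \<phi>"
      by (rule PD2_factor_le[OF assms(2) factor_map_inverse[OF assms(1) \<pi> h]])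
        (simp add: homeomorphism_apply2[OF h])
    then show "PD2 s X T1 (\<lambda>n. \<phi> n \<circ> \<pi>) = PD2 s Y T2 \<phi>"
      using le[OF \<pi>] by (rule antisym)
  }
qed

end
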